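(* Let $N>p>1$, $s>-p$, $0<\mu<\bar\mu:=\big(\frac{N-p}{p}\big)^p$ and $p^*_s-1<q<\bar q$, and let $v>0$ be a solution on $(R_0,+\infty)$, $R_0>0$, of $$-\big(r^{N-1}|v'|^{p-2}v'\big)'=\mu\,r^{N-1-p}v^{p-1}+r^{N-1+s}v^{q},\qquad r>R_0.$$ Then $$\lim_{r\to+\infty}r^{\gamma_*}v(r)=0\iff \lim_{r\to+\infty}r^{\nu_+}v(r)\in(0,+\infty),$$ and in that case $$\int^{\infty}r^{N-1}|v'|^{p}\,dr<\infty,\qquad \int^{\infty}r^{N-1-p}v^{p}\,dr<\infty,\qquad \int^{\infty}r^{N-1+s}v^{q+1}\,dr<\infty .$$
   Context: $N,p,s,\mu,q$ are real parameters. A solution of the ODE on $(R_0,+\infty)$ means a positive function $v\in C^1((R_0,+\infty))$ such that $r\mapsto r^{N-1}|v'|^{p-2}v'$ is of class $C^1$ and the equation holds pointwise. Notation: $h(\gamma):=\gamma^{p-1}\big(N-p-(p-1)\gamma\big)$ for $\gamma>0$; $\nu_-<\nu_+$ are the two roots of $h(\nu)=\mu$, which satisfy $0<\nu_-<\frac{N-p}{p}<\nu_+<\frac{N-p}{p-1}$; $\gamma_*:=\frac{p+s}{q-p+1}$; $p^*_s:=\frac{p(N+s)}{N-p}$; $\bar q:=p-1+\frac{p+s}{\nu_-}$. The condition $p^*_s-1<q<\bar q$ is equivalent to $\nu_-<\gamma_*<\frac{N-p}{p}$. The symbol $\int^\infty$ denotes integration over a neighbourhood $[R,+\infty)$ of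 infinity, $R>R_0$. *)

theory Defs
  imports "HOL-Analysis.Analysis"
begin

definition mu_bar :: "real \<Rightarrow> real \<Rightarrow> real" where
  "mu_bar N p = ((N - p) / p) powr p"

definition h_fun :: "real \<Rightarrow> real \<Rightarrow> real \<Rightarrow> real" where
  "h_fun N p \<gamma> = \<gamma> powr (p - 1) * (N - p - (p - 1) * \<gamma>)"

definition gamma_star :: "real \<Rightarrow> real \<Rightarrow> real \<Rightarrow> real" where
  "gamma_star p s q = (p + s) / (q - p + 1)"

definition p_star :: "real \<Rightarrow> real \<Rightarrow> real \<Rightarrow> real" where
  "p_star N p s = p * (N + s) / (N - p)"

definition q_bar :: "real \<Rightarrow> real \<Rightarrow> real \<Rightarrow> real" where
  "q_bar p s nu_minus = p - 1 + (p + s) / nu_minus"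

(* At a zero of the derivative of v this is 0, for 1 < p < 2 as well, since 0 powr a = 0. *)
definition flux :: "real \<Rightarrow> real \<Rightarrow> (real \<Rightarrow> real) \<Rightarrow> real \<Rightarrow> real" where
  "flux N p v r = r powr (N - 1) * \<bar>deriv v r\<bar> powr (p - 2) * deriv v r"

(* v is total on the reals, but only its values on {R\<^sub>0<..} matter:
   this set is open, so deriv v there does not depend on the other values. *)
definition ode_solution ::
  "real \<Rightarrow> real \<Rightarrow> real \<Rightarrow> real \<Rightarrow> real \<Rightarrow> real \<Rightarrow> (real \<Rightarrow> real) \<Rightarrow> bool" where
  "ode_solution N p s \<mu> q R\<^sub>0 v \<longleftrightarrow>
     (\<forall>r>R\<^sub>0. v r > 0) \<and>
     v C1_differentiable_on {R\<^sub>0<..} \<and>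
     flux N p v C1_differentiable_on {R\<^sub>0<..} \<and>
     (\<forall>r>R\<^sub>0. - deriv (flux N p v) r =
        \<mu> * r powr (N - 1 - p) * v r powr (p - 1) + r powr (N - 1 + s) * v r powr q)"

end

theory Submission
  imports Defs
begin

text \<open>
  In the variables \<open>t = ln r\<close>, \<open>V = ln v\<close>, the logarithmic derivative \<open>W = - r v' / v\<close> satisfies
  \<open>V' = - W\<close> and \<open>(W powr (p - 1))' = \<mu> - h W + G\<close>, where
  \<open>G = (r powr \<gamma> * v) powr (q - p + 1)\<close>, \<open>\<gamma> = (p + s) / (q - p + 1)\<close>, is positive and tends to
  \<open>0\<close>. The zero \<open>nu_minus\<close> of \<open>\<mu> - h\<close> attracts and \<open>nu_plus\<close> repels. Beyond \<open>nu_plus\<close> the function \<open>W\<close>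
  would blow up in finite time, hence \<open>W < nu_plus\<close> and \<open>r powr nu_plus * v\<close> increases. If \<open>W\<close> dropped
  away from \<open>nu_plus\<close>, it would fall below a level smaller than \<open>\<gamma>\<close>, contradicting
  \<open>r powr \<gamma> * v \<longlonglongrightarrow> 0\<close>. So \<open>W\<close> stays close to \<open>nu_plus\<close>, \<open>G\<close> decays exponentially in \<open>t\<close>, and since
  \<open>nu_plus - W\<close> is at most a multiple of \<open>h W - \<mu> = G - (W powr (p - 1))'\<close>, it is integrable in \<open>t\<close>.
  Hence \<open>ln (r powr nu_plus * v)\<close> converges.
\<close>

section \<open>Calculus on half-lines: barriers, growth bounds, limits and integrable tails\<close>

text \<open>At the first time where \<open>f\<close> reaches \<open>K\<close> its derivative is
  negative, so \<open>f\<close> would already exceed \<open>K\<close> slightly earlier. The sign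
  condition concerns only the level itself, so a flow can be compared with single values of its
  right-hand side.\<close>

lemma less_level_persists:
  fixes f f' :: "real \<Rightarrow> real"
  assumes der: "\<And>t. t \<ge> a \<Longrightarrow> (f has_real_derivative f' t) (at t)"
    and start: "f a < K"
    and cross: "\<And>t. t \<ge> a \<Longrightarrow> f t = K \<Longrightarrow> f' t < 0"
    and "t \<ge> a"
  shows "f t < K"
proof (rule ccontr)
  assume "\<not> f t < K"
  have cont: "continuous_on {a..t} f"
    using der by (intro continuous_at_imp_continuous_on ballI DERIV_isCont) auto
  let ?S = "{a..t} \<inter> f -` {K..}"
  have "closed ?S"
    by (rule continuous_closed_preimage[OF cont]) auto
  hence "compact ?S"
    by (metis compact_Icc compact_Int_closed inf.left_idem)
  moreover have "t \<in> ?S" using \<open>\<not> f t < K\<close> \<open>t \<ge> a\<close> by auto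
  ultimately obtain \<tau> where \<tau>: "\<tau> \<in> ?S" and first: "\<And>u. u \<in> ?S \<Longrightarrow> \<tau> \<le> u"
    by (metis compact_attains_inf empty_iff)
  have below: "f u < K" if "a \<le> u" "u < \<tau>" for u
    using first[of u] \<tau> that by force
  have "a < \<tau>" using \<tau> start by (cases "a = \<tau>") auto
  have "f \<tau> = K"
  proof (rule ccontr)
    assume "f \<tau> \<noteq> K"
    hence "f \<tau> > K" using \<tau> by auto
    moreover have "continuous_on {a..\<tau>} f"
      by (rule continuous_on_subset[OF cont]) (use \<tau> in auto)
    ultimately obtain u where "a \<le> u" "u \<le> \<tau>" "f u = K"
      using IVT'[of f a K \<tau>] start \<open>a < \<tau>\<close> by auto
    thus False using below[of u] \<open>f \<tau> \<noteq> K\<close> by (cases "u = \<tau>") auto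
  qed
  then obtain d where d: "d > 0" "\<And>h. 0 < h \<Longrightarrow> h < d \<Longrightarrow> f \<tau> < f (\<tau> - h)"
    using DERIV_neg_dec_left[OF der cross] \<open>a < \<tau>\<close> by (metis less_imp_le)
  \<comment> \<open>The minimum keeps \<open>\<tau> - h\<close> at or after \<open>a\<close>, where
    \<open>below\<close> applies.\<close>
  define h where "h = min (d / 2) (\<tau> - a)"
  have "f \<tau> < f (\<tau> - h)" using d \<open>a < \<tau>\<close> by (intro d(2)) (auto simp: h_def)
  moreover have "f (\<tau> - h) < K" using d \<open>a < \<tau>\<close> by (intro below) (auto simp: h_def)
  ultimately show False using \<open>f \<tau> = K\<close> by simp
qed

lemma greater_level_persists:
  fixes f f' :: "real \<Rightarrow> real"
  assumes der: "\<And>t. t \<ge> a \<Longrightarrow> (f has_real_derivative f' t) (at t)"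
    and "f a > K"
    and "\<And>t. t \<ge> a \<Longrightarrow> f t = K \<Longrightarrow> f' t > 0"
    and "t \<ge> a"
  shows "f t > K"
  using less_level_persists[of a "\<lambda>t. - f t" "\<lambda>t. - f' t" "- K" t] DERIV_minus[OF der] assms
  by fastforce

lemma growth_lower_bound:
  fixes f f' :: "real \<Rightarrow> real"
  assumes der: "\<And>t. t \<ge> a \<Longrightarrow> (f has_real_derivative f' t) (at t)"
    and le: "\<And>t. t \<ge> a \<Longrightarrow> d \<le> f' t"
    and "t \<ge> a"
  shows "f a + d * (t - a) \<le> f t"
proof -
  have "f a - d * a \<le> f t - d * t"
  proof (rule DERIV_nonneg_imp_nondecreasing[OF \<open>t \<ge> a\<close>])
    fix u assume "a \<le> u" "u \<le> t"
    thus "\<exists>y. ((\<lambda>t. f t - d * t) has_real_derivative y) (at u) \<and> 0 \<le> y"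
      using le[of u]
      by (intro exI[of _ "f' u - d"] conjI DERIV_diff der DERIV_cmult_Id) auto
  qed
  thus ?thesis by (simp add: algebra_simps)
qed

lemma mono_bounded_convergent_at_top:
  fixes f :: "real \<Rightarrow> real"
  assumes mono: "\<And>s t. a \<le> s \<Longrightarrow> s \<le> t \<Longrightarrow> f s \<le> f t"
    and bound: "\<And>t. a \<le> t \<Longrightarrow> f t \<le> B"
  shows "\<exists>L. (f \<longlongrightarrow> L) at_top"
proof
  let ?L = "SUP t\<in>{a..}. f t"
  have bdd: "bdd_above (f ` {a..})" using bound by (auto intro!: bdd_aboveI[of _ B])
  show "(f \<longlongrightarrow> ?L) at_top"
  proof (rule order_tendstoI)
    fix y assume "y < ?L"
    then obtain s where "s \<ge> a" "y < f s"
      using less_cSUP_iff[OF _ bdd, of y] by auto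
    thus "eventually (\<lambda>t. y < f t) at_top"
      using mono by (intro eventually_at_top_linorderI[of s]) (meson less_le_trans)
  next
    fix y assume y: "?L < y"
    show "eventually (\<lambda>t. f t < y) at_top"
      using cSUP_upper[OF _ bdd] y
      by (intro eventually_at_top_linorderI[of a]) (auto intro: le_less_trans)
  qed
qed

text \<open>A power with exponent below -1 dominates the tail, and continuity handles the compact
  interval before it.\<close>

lemma set_integrable_powr_decay:
  fixes f :: "real \<Rightarrow> real"
  assumes cont: "continuous_on {R..} f" and "R > 0" "e < -1"
    and bound: "\<And>r. r \<ge> R1 \<Longrightarrow> \<bar>f r\<bar> \<le> C * r powr e"
  shows "set_integrable lborel {R..} f"
proof -
  define R2 where "R2 = max R R1"
  have "((\<lambda>x. x powr e) has_integral -(R2 powr (e+1)) / (e+1)) {R2..}"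
    using assms by (intro has_integral_powr_to_inf) (auto simp: R2_def)
  hence "(\<lambda>x. x powr e) integrable_on {R2..}" by blast
  \<comment> \<open>The comparison is carried out for \<open>lebesgue\<close>; Borel measurability
    of \<open>f\<close> on the ray then carries the result over to \<open>lborel\<close>.\<close>
  hence "set_integrable lebesgue {R2..} (\<lambda>x. x powr e)"
    by (rule nonnegative_absolutely_integrable_1) auto
  hence maj: "set_integrable lebesgue {R2..} (\<lambda>x. C * x powr e)"
    by (rule set_integrable_mult_right)
  have "continuous_on {R2..} f" "continuous_on {R..R2} f"
    by (rule continuous_on_subset[OF cont]; force simp: R2_def)+
  have meas: "(\<lambda>x. indicat_real {R2..} x *\<^sub>R f x) \<in> borel_measurable borel"
    by (rule borel_measurable_continuous_on_indicator) (use \<open>continuous_on {R2..} f\<close> in auto)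
  hence "(\<lambda>x. indicat_real {R2..} x *\<^sub>R f x) \<in> borel_measurable lborel"
    by simp
  hence meas': "(\<lambda>x. indicat_real {R2..} x *\<^sub>R f x) \<in> borel_measurable lebesgue"
    by (rule measurable_completion)
  have "set_integrable lebesgue {R2..} f"
  proof (rule set_integrable_bound[OF maj])
    show "set_borel_measurable lebesgue {R2..} f"
      using meas' unfolding set_borel_measurable_def .
    have "\<bar>f x\<bar> \<le> \<bar>C * x powr e\<bar>" if "x \<ge> R2" for x
      using bound[of x] that by (simp add: R2_def)
    thus "AE x in lebesgue. x \<in> {R2..} \<longrightarrow> norm (f x) \<le> norm (C * x powr e)" by simp
  qed
  hence "set_integrable lborel {R2..} f"
    unfolding set_integrable_def using meas by (subst (asm) integrable_completion) auto
  moreover have "set_integrable lborel {R..R2} f"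
    using \<open>continuous_on {R..R2} f\<close> by (rule borel_integrable_atLeastAtMost')
  moreover have "{R..} = {R..R2} \<union> {R2..}" by (auto simp: R2_def)
  ultimately show ?thesis by (metis set_integrable_Un atLeastAtMost_borel sets_lborel atLeast_borel)
qed

section \<open>The shape of \<open>h_fun\<close>: rising up to \<open>(N - p) / p\<close>, falling
  beyond\<close>

lemma h_fun_has_derivative:
  assumes "\<gamma> > 0"
  shows "(h_fun N p has_real_derivative (p - 1) * \<gamma> powr (p - 2) * (N - p - p * \<gamma>)) (at \<gamma>)"
proof -
  have *: "\<gamma> powr (p - 1) = \<gamma> * \<gamma> powr (p - 2)"
    using assms by (simp add: powr_diff field_simps power2_eq_square powr_numeral)
  have **: "p - 1 - 1 = p - 2" by simp
  have "((\<lambda>\<gamma>. \<gamma> powr (p - 1) * (N - p - (p - 1) * \<gamma>)) has_real_derivative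
      \<gamma> powr (p - 1) * (0 - (p - 1)) + (p - 1) * \<gamma> powr (p - 1 - 1) * (N - p - (p - 1) * \<gamma>)) (at \<gamma>)"
    by (intro DERIV_mult' DERIV_diff DERIV_const DERIV_cmult_Id has_real_derivative_powr assms)
  thus ?thesis
    unfolding h_fun_def [abs_def] ** by (simp add: * algebra_simps)
qed

lemma h_fun_continuous_on:
  assumes "a > 0"
  shows "continuous_on {a..b} (h_fun N p)"
proof (intro continuous_at_imp_continuous_on ballI)
  fix x assume "x \<in> {a..b}"
  thus "isCont (h_fun N p) x" using assms by (intro DERIV_isCont[OF h_fun_has_derivative]) auto
qed

lemma h_fun_strict_mono:
  assumes "1 < p" "0 < a" "a < b" "b \<le> (N - p) / p"
  shows "h_fun N p a < h_fun N p b"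
proof (rule DERIV_pos_imp_increasing_open[OF \<open>a < b\<close>])
  fix x assume x: "a < x" "x < b"
  hence "x < (N - p) / p" using assms by linarith
  hence "p * x < N - p" using assms by (simp add: field_simps)
  hence "(p - 1) * x powr (p - 2) * (N - p - p * x) > 0" using assms x by simp
  thus "\<exists>y. (h_fun N p has_real_derivative y) (at x) \<and> 0 < y"
    using h_fun_has_derivative[of x N p] assms x by force
next
  show "continuous_on {a..b} (h_fun N p)"
    using assms by (intro h_fun_continuous_on) auto
qed

lemma h_fun_strict_antimono:
  assumes "1 < p" "p < N" "(N - p) / p \<le> a" "a < b"
  shows "h_fun N p b < h_fun N p a"
proof (rule DERIV_neg_imp_decreasing_open[OF \<open>a < b\<close>])
  have "0 < (N - p) / p" using assms by simp
  hence "0 < a" using assms by linarith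
  fix x assume x: "a < x" "x < b"
  hence "(N - p) / p < x" using assms by linarith
  hence "N - p < p * x" using assms by (simp add: field_simps)
  hence "(p - 1) * x powr (p - 2) * (N - p - p * x) < 0"
    using assms x \<open>0 < a\<close> by (intro mult_pos_neg) auto
  thus "\<exists>y. (h_fun N p has_real_derivative y) (at x) \<and> y < 0"
    using h_fun_has_derivative[of x N p] \<open>0 < a\<close> x by force
next
  have "0 < (N - p) / p" using assms by simp
  hence "0 < a" using assms by linarith
  thus "continuous_on {a..b} (h_fun N p)"
    using assms by (intro h_fun_continuous_on) auto
qed

text \<open>By the mean value theorem the drop of \<open>h_fun\<close> is \<open>\<nu> - w\<close>
  times a value of minus its derivative, which is bounded below by a positive constant on the right
  of \<open>\<kappa>\<close>. This later controls \<open>nu_plus - W\<close> by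
  \<open>h_fun N p W - \<mu>\<close>.\<close>

lemma h_fun_linear_decrease:
  assumes "1 < p" "p < N" "(N - p) / p < \<kappa>"
  obtains c where "c > 0"
    and "\<And>w. \<kappa> \<le> w \<Longrightarrow> w \<le> \<nu> \<Longrightarrow> c * (\<nu> - w) \<le> h_fun N p w - h_fun N p \<nu>"
proof -
  have "0 < (N - p) / p" using assms by simp
  hence "0 < \<kappa>" using assms by linarith
  moreover have "N - p < p * \<kappa>" using assms by (simp add: field_simps)
  ultimately have \<kappa>: "0 < \<kappa>" "N - p < p * \<kappa>" by auto
  \<comment> \<open>Each factor of the negated derivative is replaced by a lower bound. The minimum
    covers both monotonicity cases of \<open>z powr (p - 2)\<close>, that is
    \<open>p \<ge> 2\<close> and \<open>p < 2\<close>.\<close>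
  define c where "c = (p - 1) * min (\<kappa> powr (p - 2)) (\<nu> powr (p - 2)) * (p * \<kappa> - (N - p))"
  have less: "c * (\<nu> - w) \<le> h_fun N p w - h_fun N p \<nu>" if w: "\<kappa> \<le> w" "w < \<nu>" for w
  proof -
    have "\<exists>z. w < z \<and> z < \<nu> \<and> h_fun N p \<nu> - h_fun N p w =
            (\<nu> - w) * ((p - 1) * z powr (p - 2) * (N - p - p * z))"
      using w \<kappa> by (intro MVT2 h_fun_has_derivative) auto
    then obtain z where z: "w < z" "z < \<nu>"
      and eq: "h_fun N p w - h_fun N p \<nu> = (\<nu> - w) * ((p - 1) * z powr (p - 2) * (p * z - (N - p)))"
      by (auto simp: algebra_simps)
    have "min (\<kappa> powr (p - 2)) (\<nu> powr (p - 2)) \<le> z powr (p - 2)"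
    proof (cases "p \<ge> 2")
      case True
      have "\<kappa> powr (p - 2) \<le> z powr (p - 2)" using True z w \<kappa> by (intro powr_mono2) auto
      thus ?thesis by simp
    next
      case False
      have "\<nu> powr (p - 2) \<le> z powr (p - 2)" using False z w \<kappa> by (intro powr_mono2') auto
      thus ?thesis by simp
    qed
    moreover have "p * \<kappa> \<le> p * z" using z w assms by simp
    ultimately have "c \<le> (p - 1) * z powr (p - 2) * (p * z - (N - p))"
      unfolding c_def using assms \<kappa> by (intro mult_mono) auto
    thus ?thesis unfolding eq using z by (simp add: mult.commute mult_left_mono)
  qed
  show ?thesis
  proof (cases "\<kappa> < \<nu>")
    case True
    hence "c > 0" unfolding c_def using assms \<kappa> by auto
    moreover have "c * (\<nu> - w) \<le> h_fun N p w - h_fun N p \<nu>" if "\<kappa> \<le> w" "w \<le> \<nu>" for w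
      using less[of w] that by (cases "w = \<nu>") auto
    ultimately show ?thesis by (rule that)
  next
    \<comment> \<open>At most \<open>w = \<nu>\<close> is left, where both sides vanish, so any
      positive constant serves.\<close>
    case False
    have "w = \<nu>" if "\<kappa> \<le> w" "w \<le> \<nu>" for w using False that by simp
    thus ?thesis by (intro that[of 1]) force+
  qed
qed

section \<open>The flow of the logarithmic derivative in the variable \<open>t\<close>\<close>

text \<open>The equation is imposed on \<open>W powr (p - 1)\<close> rather than on \<open>W\<close>
  because this power is the negated flux times a differentiable factor, and the notion of solution
  provides a derivative of the flux, not of \<open>deriv v\<close>.\<close>

locale log_derivative_flow =
  fixes N p \<mu> nu_minus nu_plus \<gamma> \<beta> T :: real and V W :: "real \<Rightarrow> real"
  assumes p: "1 < p" "p < N"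
    and nu: "0 < nu_minus" "nu_minus < nu_plus" "h_fun N p nu_minus = \<mu>" "h_fun N p nu_plus = \<mu>"
    and \<mu>_pos: "\<mu> > 0"
    and \<gamma>: "nu_minus < \<gamma>" "\<gamma> < (N - p) / p"
    and \<beta>: "\<beta> > 0"
    and W_pos: "\<And>t. t > T \<Longrightarrow> W t > 0"
    and V_deriv: "\<And>t. t > T \<Longrightarrow> (V has_real_derivative - W t) (at t)"
    and Y_deriv: "\<And>t. t > T \<Longrightarrow> ((\<lambda>t. W t powr (p - 1)) has_real_derivative
                    \<mu> - h_fun N p (W t) + exp (\<beta> * (\<gamma> * t + V t))) (at t)"
    and to_zero: "filterlim (\<lambda>t. \<gamma> * t + V t) at_bot at_top"
begin

definition G :: "real \<Rightarrow> real" where "G t = exp (\<beta> * (\<gamma> * t + V t))"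

lemma G_pos: "G t > 0"
  by (simp add: G_def)

text \<open>Otherwise both roots would lie where \<open>h_fun\<close> strictly increases, and its
  values there would differ.\<close>

lemma nu_plus_gt: "(N - p) / p < nu_plus"
  using h_fun_strict_mono[of p nu_minus nu_plus N] p nu by force

lemma h_less_mu:
  assumes "w > nu_plus"
  shows "h_fun N p w < \<mu>"
  using h_fun_strict_antimono[of p N nu_plus w] nu_plus_gt p nu assms by simp

text \<open>A function that rises and then falls is smallest over an interval at one of the
  endpoints. The smaller end value gives a uniform margin above \<open>\<mu>\<close>.\<close>

lemma h_gt_mu:
  assumes "nu_minus < a" "a \<le> w" "w \<le> b" "b < nu_plus"
  shows "\<mu> < min (h_fun N p a) (h_fun N p b)" "min (h_fun N p a) (h_fun N p b) \<le> h_fun N p w"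
proof -
  have below: "\<mu> < h_fun N p x" if "nu_minus < x" "x \<le> (N - p) / p" for x
    using h_fun_strict_mono[of p nu_minus x N] that p nu by simp
  have above: "\<mu> < h_fun N p x" if "(N - p) / p \<le> x" "x < nu_plus" for x
    using h_fun_strict_antimono[of p N x nu_plus] that p nu by simp
  have "\<mu> < h_fun N p x" if "nu_minus < x" "x < nu_plus" for x
    using below above that by (meson linear)
  thus "\<mu> < min (h_fun N p a) (h_fun N p b)"
    using assms by simp
  have "h_fun N p a \<le> h_fun N p w" if "w \<le> (N - p) / p"
    using h_fun_strict_mono[of p a w N] that p nu assms by (cases "a = w") auto
  moreover have "h_fun N p b \<le> h_fun N p w" if "w > (N - p) / p"
    using h_fun_strict_antimono[of p N w b] that p nu assms by (cases "b = w") auto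
  ultimately show "min (h_fun N p a) (h_fun N p b) \<le> h_fun N p w"
    by linarith
qed

lemma W_powr_less_iff:
  assumes "t > T" "w > 0"
  shows "W t powr (p - 1) < w powr (p - 1) \<longleftrightarrow> W t < w"
    and "w powr (p - 1) < W t powr (p - 1) \<longleftrightarrow> w < W t"
  using W_pos[of t] p assms powr_less_mono2[of "p - 1" "W t" w] powr_less_cancel2[of "p - 1" "W t" w]
    powr_less_mono2[of "p - 1" w "W t"] powr_less_cancel2[of "p - 1" w "W t"]
  by auto

lemma W_powr_eq_iff: "t > T \<Longrightarrow> w > 0 \<Longrightarrow> W t powr (p - 1) = w powr (p - 1) \<longleftrightarrow> W t = w"
  using W_powr_less_iff(1)[of t w] W_powr_less_iff(2)[of t w] by force

lemma Y_deriv': "t > T \<Longrightarrow> ((\<lambda>t. W t powr (p - 1)) has_real_derivative \<mu> - h_fun N p (W t) + G t) (at t)"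
  using Y_deriv by (simp add: G_def)

text \<open>\<open>1 / W\<close> is a power of \<open>W powr (p - 1)\<close>, so the chain rule
  applies. The reciprocal is useful because \<open>h_fun N p w * w powr (- p)\<close> is affine in
  \<open>1 / w\<close>.\<close>

lemma inverse_W_deriv:
  assumes t: "t > T"
  shows "((\<lambda>t. 1 / W t) has_real_derivative
           (N - p) / (p - 1) * (1 / W t) - 1 - (\<mu> + G t) / (p - 1) * W t powr (- p)) (at t)"
proof -
  define e where "e = - 1 / (p - 1)"
  define w where "w = W t"
  have w: "w > 0" unfolding w_def by (rule W_pos[OF t])
  have e: "(p - 1) * e = -1" "(p - 1) * (e - 1) = - p" using p by (simp_all add: e_def field_simps)
  define D where "D = e * (w powr (p - 1)) powr (e - 1) * (\<mu> - h_fun N p w + G t)"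
  have D: "((\<lambda>t. (W t powr (p - 1)) powr e) has_real_derivative D) (at t)"
    unfolding D_def w_def using w
    by (intro DERIV_chain2[OF has_real_derivative_powr Y_deriv'] t) (simp add: w_def)
  have eq: "(W u powr (p - 1)) powr e = 1 / W u" if "u > T" for u
    using W_pos[OF that] by (simp add: powr_powr e powr_minus_divide)
  have ev: "eventually (\<lambda>u. (W u powr (p - 1)) powr e = 1 / W u) (nhds t)"
    by (rule eventually_mono[OF eventually_nhds_in_open[of "{T<..}"]]) (use t eq in auto)
  have "((\<lambda>t. 1 / W t) has_real_derivative D) (at t)"
    using D by (rule iffD1[OF DERIV_cong_ev[OF refl ev refl]])
  moreover have "D = (N - p) / (p - 1) * (1 / w) - 1 - (\<mu> + G t) / (p - 1) * w powr (- p)"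
  proof -
    define P where "P = w powr (- p)"
    have "w powr (p - 1) * P = w powr (- 1)"
      unfolding P_def powr_add[symmetric] by simp
    hence "w powr (p - 1) * P = 1 / w"
      using w by (simp add: powr_minus_divide)
    moreover have "h_fun N p w * P = (w powr (p - 1) * P) * (N - p - (p - 1) * w)"
      by (simp add: h_fun_def)
    ultimately have "h_fun N p w * P = (N - p) / w - (p - 1)"
      using w by (simp add: diff_divide_distrib)
    moreover have "(w powr (p - 1)) powr (e - 1) = P" by (simp only: powr_powr e P_def)
    hence "D = e * P * (\<mu> + G t) - e * (h_fun N p w * P)"
      by (simp add: D_def algebra_simps)
    ultimately have "D = e * P * (\<mu> + G t) - e * ((N - p) / w - (p - 1))" by simp
    also have "\<dots> = - e * (N - p) * (1 / w) + (p - 1) * e - (- e) * (\<mu> + G t) * P"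
      by (simp add: algebra_simps diff_divide_distrib)
    finally show ?thesis using e by (simp add: e_def P_def)
  qed
  ultimately show ?thesis by (simp add: w_def)
qed

text \<open>Above this level the reciprocal of \<open>W\<close>, whose equation is linear up to a negative term,
  would become negative in finite time.\<close>
lemma W_le:
  assumes t0: "t0 > T"
  shows "W t0 \<le> (N - p) / (p - 1)"
proof (rule ccontr)
  define K where "K = (N - p) / (p - 1)"
  have K: "K > 0" using p by (simp add: K_def)
  \<comment> \<open>The exponential is the integrating factor for the linear part
    \<open>K * z - 1\<close> of the equation of \<open>z = 1 / W\<close>, whose equilibrium is
    \<open>1 / K\<close>. Only the negative term survives in the derivative of
    \<open>Q\<close>.\<close>
  define Q where "Q t = exp (- K * t) * (1 / W t - 1 / K)" for t
  assume "\<not> W t0 \<le> (N - p) / (p - 1)"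
  hence "1 / W t0 < 1 / K"
    using K W_pos[OF t0] by (intro divide_strict_left_mono mult_pos_pos) (simp_all flip: K_def)
  hence neg: "Q t0 < 0" unfolding Q_def by (intro mult_pos_neg) simp_all
  have Q_le: "Q t \<le> Q t0" if "t \<ge> t0" for t
  proof (rule DERIV_nonpos_imp_nonincreasing[OF that])
    fix u assume "t0 \<le> u" "u \<le> t"
    hence u: "u > T" using t0 by simp
    have "((\<lambda>t. exp (- K * t)) has_real_derivative exp (- K * u) * (- K)) (at u)"
      by (auto intro!: derivative_eq_intros)
    moreover have "((\<lambda>t. 1 / W t - 1 / K) has_real_derivative
        (K * (1 / W u) - 1 - (\<mu> + G u) / (p - 1) * W u powr (- p)) - 0) (at u)"
      unfolding K_def by (intro DERIV_diff inverse_W_deriv u DERIV_const)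
    ultimately have "(Q has_real_derivative
        exp (- K * u) * ((K * (1 / W u) - 1 - (\<mu> + G u) / (p - 1) * W u powr (- p)) - 0)
        + exp (- K * u) * (- K) * (1 / W u - 1 / K)) (at u)"
      unfolding Q_def [abs_def] by (rule DERIV_mult')
    moreover have "exp (- K * u) * ((K * (1 / W u) - 1 - x) - 0)
        + exp (- K * u) * (- K) * (1 / W u - 1 / K) = - exp (- K * u) * x" for x
      using K by (simp add: algebra_simps)
    ultimately have "(Q has_real_derivative
        - exp (- K * u) * ((\<mu> + G u) / (p - 1) * W u powr (- p))) (at u)" by simp
    moreover have "(\<mu> + G u) / (p - 1) * W u powr (- p) \<ge> 0"
      using \<mu>_pos G_pos[of u] p by simp
    hence "- exp (- K * u) * ((\<mu> + G u) / (p - 1) * W u powr (- p)) \<le> 0"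
      by (intro mult_nonpos_nonneg) simp_all
    ultimately show "\<exists>y. (Q has_real_derivative y) (at u) \<and> y \<le> 0" by blast
  qed
  define c where "c = - (K * Q t0)"
  have c: "c > 0" using K neg by (simp add: c_def mult_pos_neg)
  \<comment> \<open>At this time \<open>K * t * c\<close> is at least 1. As the exponential exceeds
    its argument, this forces \<open>K / W t \<le> 0\<close>.\<close>
  define t where "t = max t0 (1 / (K * c))"
  have t: "t \<ge> t0" "t > T" using t0 by (auto simp: t_def)
  have "1 / (K * c) \<le> t" by (simp add: t_def)
  hence "1 \<le> (K * t) * c" using K c by (simp add: pos_divide_le_eq mult_ac)
  also have "\<dots> \<le> exp (K * t) * c"
  proof (rule mult_right_mono)
    show "K * t \<le> exp (K * t)" using exp_ge_add_one_self[of "K * t"] by linarith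
  qed (use c in simp)
  also have "\<dots> \<le> exp (K * t) * (- (K * Q t))"
    using Q_le[OF t(1)] K by (simp add: c_def)
  also have "\<dots> = 1 - K / W t"
    using K by (simp add: Q_def exp_minus field_simps)
  finally have "K / W t \<le> 0" by simp
  thus False using K W_pos[OF t(2)] by (simp add: divide_le_0_iff)
qed

text \<open>At or above \<open>nu_plus\<close> the positive term \<open>G\<close> pushes
  \<open>W\<close> strictly upwards. Then \<open>W\<close> stays above a level
  \<open>a > nu_plus\<close>, where \<open>\<mu> - h_fun\<close> is bounded below by
  \<open>\<delta> > 0\<close>, and linear growth of \<open>W powr (p - 1)\<close> contradicts
  \<open>W_le\<close>.\<close>

lemma W_less_nu_plus:
  assumes t0: "t0 > T"
  shows "W t0 < nu_plus"
proof (rule ccontr)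
  have pos: "nu_plus > 0" using nu by simp
  assume "\<not> W t0 < nu_plus"
  hence "h_fun N p (W t0) \<le> \<mu>" using h_less_mu[of "W t0"] nu by (cases "W t0 = nu_plus") auto
  hence "\<mu> - h_fun N p (W t0) + G t0 > 0" using G_pos[of t0] by simp
  then obtain d where "d > 0" "\<And>h. 0 < h \<Longrightarrow> h < d \<Longrightarrow> W t0 powr (p - 1) < W (t0 + h) powr (p - 1)"
    using DERIV_pos_inc_right[OF Y_deriv'[OF t0]] by metis
  hence "W t0 powr (p - 1) < W (t0 + d / 2) powr (p - 1)" by simp
  hence "W t0 < W (t0 + d / 2)"
    using W_powr_less_iff(2)[of "t0 + d / 2" "W t0"] \<open>d > 0\<close> t0 W_pos by simp
  define t1 where "t1 = t0 + d / 2"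
  have t1: "t1 > T" "nu_plus < W t1"
    using \<open>W t0 < W (t0 + d / 2)\<close> \<open>\<not> W t0 < nu_plus\<close> t0 \<open>d > 0\<close> by (auto simp: t1_def)
  then obtain a where a: "nu_plus < a" "a < W t1" using dense by blast
  define \<delta> where "\<delta> = \<mu> - h_fun N p a"
  have \<delta>: "\<delta> > 0" using h_less_mu[OF a(1)] by (simp add: \<delta>_def)
  have ha: "h_fun N p w \<le> h_fun N p a" if "a \<le> w" for w
    using h_fun_strict_antimono[of p N a w] that a p nu_plus_gt by (cases "a = w") auto
  have W_gt: "W t > a" if "t \<ge> t1" for t
  proof -
    have "W t powr (p - 1) > a powr (p - 1)"
    proof (rule greater_level_persists[OF Y_deriv' _ _ that])
      show "a powr (p - 1) < W t1 powr (p - 1)"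
        using W_powr_less_iff(2)[of t1 a] t1 a pos by simp
      fix u assume u: "t1 \<le> u" "W u powr (p - 1) = a powr (p - 1)"
      hence "W u = a" using W_powr_eq_iff[of u a] t1 a pos by simp
      thus "\<mu> - h_fun N p (W u) + G u > 0" using \<delta> G_pos[of u] by (simp add: \<delta>_def)
    qed (use t1 in auto)
    thus ?thesis using W_powr_less_iff(2)[of t a] that t1 a pos by simp
  qed
  have grow: "W t1 powr (p - 1) + \<delta> * (t - t1) \<le> W t powr (p - 1)" if "t \<ge> t1" for t
  proof (rule growth_lower_bound[OF Y_deriv' _ that])
    fix u assume u: "t1 \<le> u"
    show "\<delta> \<le> \<mu> - h_fun N p (W u) + G u"
      using ha[of "W u"] W_gt[OF u] G_pos[of u] by (simp add: \<delta>_def)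
  qed (use t1 in auto)
  define M where "M = ((N - p) / (p - 1)) powr (p - 1)"
  \<comment> \<open>By this time the guaranteed growth alone uses up the bound
    \<open>M\<close>.\<close>
  define t where "t = t1 + M / \<delta>"
  have "t \<ge> t1" using \<delta> by (simp add: t_def M_def)
  have "W t powr (p - 1) \<le> M"
    unfolding M_def using W_le[of t] W_pos[of t] \<open>t \<ge> t1\<close> t1 p by (intro powr_mono2) auto
  moreover have "\<delta> * (t - t1) = M" using \<delta> by (simp add: t_def)
  moreover have "W t1 powr (p - 1) > 0" using W_pos[OF t1(1)] by simp
  ultimately show False using grow[OF \<open>t \<ge> t1\<close>] by linarith
qed

text \<open>On the level \<open>w\<close> the bound on \<open>G\<close> makes the derivative of
  \<open>W powr (p - 1)\<close> negative, so the level is a barrier from above.\<close>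

lemma W_stays_below:
  assumes t: "t0 > T" "t \<ge> t0" and w: "0 < w" "W t0 < w"
    and G: "\<And>u. u \<ge> t0 \<Longrightarrow> \<mu> + G u < h_fun N p w"
  shows "W t < w"
proof -
  have "W t powr (p - 1) < w powr (p - 1)"
  proof (rule less_level_persists[OF Y_deriv' _ _ t(2)])
    show "W t0 powr (p - 1) < w powr (p - 1)"
      using W_powr_less_iff(1)[of t0 w] t w by simp
    fix u assume u: "t0 \<le> u" "W u powr (p - 1) = w powr (p - 1)"
    hence "W u = w" using W_powr_eq_iff[of u w] t w by simp
    thus "\<mu> - h_fun N p (W u) + G u < 0" using G[of u] u by simp
  qed (use t in auto)
  thus ?thesis using W_powr_less_iff(1)[of t w] t w by simp
qed

lemma G_tendsto_0: "(G \<longlongrightarrow> 0) at_top"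
proof -
  have "filterlim (\<lambda>t. \<beta> * (\<gamma> * t + V t)) at_bot at_top"
    using \<beta> to_zero by (simp add: filterlim_tendsto_pos_mult_at_bot[OF tendsto_const])
  thus ?thesis unfolding G_def [abs_def] by (rule filterlim_compose[OF exp_at_bot])
qed

text \<open>If \<open>W\<close> dropped below \<open>\<kappa>\<close> late enough, it would fall below a level smaller than \<open>\<gamma>\<close> and stay
  there, which is incompatible with \<open>\<gamma> * t + V t\<close> tending to minus infinity.\<close>
lemma W_eventually_ge:
  assumes \<kappa>: "\<gamma> < \<kappa>" "\<kappa> < nu_plus"
  obtains T' where "T' > T" "\<And>t. t \<ge> T' \<Longrightarrow> W t \<ge> \<kappa>"
proof -
  \<comment> \<open>Being above \<open>nu_minus\<close>, the level \<open>g\<close> is a barrier for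
    small \<open>G\<close>; being below \<open>\<gamma>\<close>, it makes
    \<open>\<gamma> * t + V t\<close> increase as long as \<open>W < g\<close>.\<close>
  obtain g where g: "nu_minus < g" "g < \<gamma>" using \<gamma> dense by blast
  hence g0: "g > 0" using nu by simp
  define m where "m = min (h_fun N p g) (h_fun N p \<kappa>)"
  have m: "\<mu> < m" unfolding m_def by (rule h_gt_mu(1)[of g \<kappa> \<kappa>]) (use g \<kappa> in auto)
  have m_le: "m \<le> h_fun N p w" if "g \<le> w" "w \<le> \<kappa>" for w
    unfolding m_def by (rule h_gt_mu(2)) (use g \<kappa> that in auto)
  \<comment> \<open>One half of the gap absorbs \<open>G\<close>; the other half is the rate at
    which \<open>W powr (p - 1)\<close> falls while \<open>W\<close> lies between \<open>g\<close>
    and \<open>\<kappa>\<close>, so that \<open>W\<close> must leave through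
    \<open>g\<close>.\<close>
  define \<delta> where "\<delta> = (m - \<mu>) / 2"
  have \<delta>: "\<delta> > 0" "\<mu> + \<delta> < m" using m by (auto simp: \<delta>_def field_simps)
  have "eventually (\<lambda>t. G t < \<delta>) at_top"
    using order_tendstoD(2)[OF G_tendsto_0] \<delta> by simp
  then obtain T1 where T1: "\<And>t. t \<ge> T1 \<Longrightarrow> G t < \<delta>" by (auto simp: eventually_at_top_linorder)
  define T' where "T' = max (T + 1) T1"
  have T': "T' > T" by (simp add: T'_def)
  have G: "\<mu> + G t < m - \<delta>" if "t \<ge> T'" for t
    using T1[of t] that by (simp add: T'_def \<delta>_def field_simps)
  have "W t \<ge> \<kappa>" if "t \<ge> T'" for t
  proof (rule ccontr)
    assume "\<not> W t \<ge> \<kappa>"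
    have "t > T" using that T' by simp
    have below: "W u < \<kappa>" if "u \<ge> t" for u
    proof (rule W_stays_below[OF \<open>t > T\<close> that])
      fix u assume "t \<le> u"
      thus "\<mu> + G u < h_fun N p \<kappa>"
        using G[of u] \<open>t \<ge> T'\<close> m_le[of \<kappa>] \<kappa> g \<delta> by simp
    qed (use \<open>\<not> W t \<ge> \<kappa>\<close> \<kappa> \<gamma> nu in auto)
    have "\<exists>u\<ge>t. W u < g"
    proof (rule ccontr)
      assume "\<not> (\<exists>u\<ge>t. W u < g)"
      hence above: "W u \<ge> g" if "u \<ge> t" for u using that by force
      have fall: "- (W t powr (p - 1)) + \<delta> * (u - t) \<le> - (W u powr (p - 1))" if "u \<ge> t" for u
      proof (rule growth_lower_bound[OF DERIV_minus[OF Y_deriv'] _ that])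
        fix u assume u: "t \<le> u"
        show "\<delta> \<le> - (\<mu> - h_fun N p (W u) + G u)"
          using m_le[of "W u"] below[OF u] above[OF u] G[of u] u \<open>t \<ge> T'\<close> by simp
      qed (use \<open>t > T\<close> in auto)
      define u where "u = t + W t powr (p - 1) / \<delta>"
      have "u \<ge> t" using \<delta> by (simp add: u_def)
      moreover have "\<delta> * (u - t) = W t powr (p - 1)" using \<delta> by (simp add: u_def)
      ultimately have "W u powr (p - 1) \<le> 0" using fall[of u] by linarith
      thus False using W_pos[of u] \<open>u \<ge> t\<close> \<open>t > T\<close> by (simp add: not_le[symmetric])
    qed
    then obtain a where a: "a \<ge> t" "W a < g" by blast
    have low: "W u < g" if "u \<ge> a" for u
    proof (rule W_stays_below[OF _ that g0 a(2)])
      fix u assume "a \<le> u"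
      thus "\<mu> + G u < h_fun N p g"
        using G[of u] \<open>t \<ge> T'\<close> a m_le[of g] \<kappa> g \<delta> by simp
    qed (use a \<open>t > T\<close> in auto)
    have V_ge: "V a + (- g) * (u - a) \<le> V u" if "u \<ge> a" for u
      by (rule growth_lower_bound[OF V_deriv _ that]) (use low a \<open>t > T\<close> in \<open>auto intro: less_imp_le\<close>)
    \<comment> \<open>Requiring \<open>u \<ge> 0\<close> turns \<open>g < \<gamma>\<close> into
      \<open>g * u \<le> \<gamma> * u\<close>, which clashes with \<open>V_ge\<close>.\<close>
    have "eventually (\<lambda>u. \<gamma> * u + V u < V a + g * a \<and> u \<ge> max 0 a) at_top"
      using to_zero
      by (intro eventually_conj eventually_ge_at_top) (simp add: filterlim_at_bot_dense)
    then obtain u where u: "\<gamma> * u + V u < V a + g * a" "u \<ge> max 0 a"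
      using eventually_happens'[OF trivial_limit_at_top_linorder] by blast
    have "g * u \<le> \<gamma> * u" using g u by (intro mult_right_mono) auto
    thus False using V_ge[of u] u by (simp add: algebra_simps)
  qed
  with T' show ?thesis by (rule that)
qed

text \<open>The derivative \<open>nu_plus - W\<close> is positive by \<open>W_less_nu_plus\<close>,
  so only an upper bound is missing; the nonincreasing function \<open>\<Psi>\<close> supplies
  it.\<close>

lemma nu_plus_limit: "\<exists>L. ((\<lambda>t. nu_plus * t + V t) \<longlongrightarrow> L) at_top"
proof -
  \<comment> \<open>Beyond \<open>(N - p) / p\<close> the linear estimate for \<open>h_fun\<close>
    is available, and \<open>\<kappa> > \<gamma>\<close> follows as well.\<close>
  obtain \<kappa> where \<kappa>: "(N - p) / p < \<kappa>" "\<kappa> < nu_plus" using dense[OF nu_plus_gt] by blast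
  have "\<gamma> < \<kappa>" using \<gamma> \<kappa> by simp
  obtain T' where T': "T' > T" and W_ge: "\<And>t. t \<ge> T' \<Longrightarrow> W t \<ge> \<kappa>"
    using W_eventually_ge[OF \<open>\<gamma> < \<kappa>\<close> \<kappa>(2)] by blast
  obtain c where c: "c > 0"
    and lin: "\<And>w. \<kappa> \<le> w \<Longrightarrow> w \<le> nu_plus \<Longrightarrow> c * (nu_plus - w) \<le> h_fun N p w - h_fun N p nu_plus"
    using h_fun_linear_decrease[OF p \<kappa>(1)] by metis
  \<comment> \<open>With \<open>W \<ge> \<kappa>\<close> the exponent of \<open>G\<close> falls at
    least at the rate \<open>\<eta>\<close>.\<close>
  define \<eta> where "\<eta> = \<beta> * (\<kappa> - \<gamma>)"
  have \<eta>: "\<eta> > 0" using \<beta> \<open>\<gamma> < \<kappa>\<close> by (simp add: \<eta>_def)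
  define A where "A = exp (\<beta> * (V T' + \<kappa> * T'))"
  have G_le: "G t \<le> A * exp (- \<eta> * t)" if "t \<ge> T'" for t
  proof -
    have "- V T' + \<kappa> * (t - T') \<le> - V t"
      by (rule growth_lower_bound[OF DERIV_minus[OF V_deriv] _ that]) (use T' W_ge in auto)
    hence "\<beta> * (\<gamma> * t + V t) \<le> \<beta> * (\<gamma> * t + V T' - \<kappa> * (t - T'))"
      using \<beta> by (intro mult_left_mono) (auto simp: algebra_simps)
    also have "\<dots> = \<beta> * (V T' + \<kappa> * T') + - \<eta> * t" by (simp add: \<eta>_def algebra_simps)
    finally show ?thesis by (simp add: G_def A_def flip: exp_add)
  qed
  define U where "U t = nu_plus * t + V t" for t
  have U_deriv: "(U has_real_derivative nu_plus - W t) (at t)" if "t > T" for t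
    unfolding U_def [abs_def] using DERIV_add[OF DERIV_cmult_Id V_deriv[OF that]] by simp
  \<comment> \<open>The last summand of \<open>\<Psi>\<close> is chosen so that its derivative cancels the bound on \<open>G\<close>.\<close>
  define \<Psi> where "\<Psi> t = c * U t + W t powr (p - 1) + (A / \<eta>) * exp (- \<eta> * t)" for t
  have \<Psi>_le: "\<Psi> t \<le> \<Psi> T'" if "t \<ge> T'" for t
  proof (rule DERIV_nonpos_imp_nonincreasing[OF that])
    fix u assume "T' \<le> u" "u \<le> t"
    hence u: "u > T" using T' by simp
    have "((\<lambda>t. exp (- \<eta> * t)) has_real_derivative exp (- \<eta> * u) * (- \<eta>)) (at u)"
      by (auto intro!: derivative_eq_intros)
    hence "(\<Psi> has_real_derivative c * (nu_plus - W u) + (\<mu> - h_fun N p (W u) + G u)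
             + (A / \<eta>) * (exp (- \<eta> * u) * (- \<eta>))) (at u)"
      unfolding \<Psi>_def [abs_def] by (intro DERIV_add DERIV_cmult U_deriv Y_deriv' u)
    moreover have "c * (nu_plus - W u) + (\<mu> - h_fun N p (W u) + G u)
             + (A / \<eta>) * (exp (- \<eta> * u) * (- \<eta>)) \<le> 0"
      using lin[of "W u"] W_ge[OF \<open>T' \<le> u\<close>] W_less_nu_plus[OF u] G_le[OF \<open>T' \<le> u\<close>] nu \<eta> by simp
    ultimately show "\<exists>y. (\<Psi> has_real_derivative y) (at u) \<and> y \<le> 0" by blast
  qed
  have "\<exists>L. (U \<longlongrightarrow> L) at_top"
  proof (rule mono_bounded_convergent_at_top)
    fix s t assume st: "T' \<le> s" "s \<le> t"
    show "U s \<le> U t"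
    proof (rule DERIV_nonneg_imp_nondecreasing[OF st(2)])
      fix u assume "s \<le> u" "u \<le> t"
      hence "u > T" using st T' by simp
      thus "\<exists>y. (U has_real_derivative y) (at u) \<and> 0 \<le> y"
        using U_deriv W_less_nu_plus by (metis diff_ge_0_iff_ge less_imp_le)
    qed
  next
    fix t assume t: "T' \<le> t"
    \<comment> \<open>The last two summands of \<open>\<Psi>\<close> are nonnegative, so
      \<open>c * U t\<close> is at most \<open>\<Psi> t\<close>.\<close>
    have "0 \<le> A / \<eta> * exp (- \<eta> * t)" using \<eta> by (simp add: A_def)
    hence "c * U t \<le> \<Psi> T'" using \<Psi>_le[OF t] unfolding \<Psi>_def [of t] by (smt (verit) powr_ge_zero)
    thus "U t \<le> \<Psi> T' / c" using c by (simp add: field_simps)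
  qed
  thus ?thesis by (simp add: U_def [abs_def])
qed

end

section \<open>From the radial equation to the flow in \<open>t = ln r\<close>\<close>

lemma flux_neg_iff:
  assumes "r > 0"
  shows "flux N p v r < 0 \<longleftrightarrow> deriv v r < 0"
proof (cases "deriv v r < 0")
  case True
  thus ?thesis using assms by (simp add: flux_def mult_pos_neg)
next
  case False
  hence "flux N p v r \<ge> 0" by (simp add: flux_def)
  thus ?thesis using False by simp
qed

context
  fixes N p s \<mu> q R\<^sub>0 :: real and v :: "real \<Rightarrow> real"
  assumes sol: "ode_solution N p s \<mu> q R\<^sub>0 v" and R0: "R\<^sub>0 > 0"
begin

lemma solution_pos: "r > R\<^sub>0 \<Longrightarrow> v r > 0"
  using sol by (simp add: ode_solution_def)

lemma C1_deriv:
  assumes "f C1_differentiable_on {R\<^sub>0<..}"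
  shows "r > R\<^sub>0 \<Longrightarrow> (f has_real_derivative deriv f r) (at r)" "continuous_on {R\<^sub>0<..} (deriv f)"
proof -
  obtain D where D: "\<And>r. r > R\<^sub>0 \<Longrightarrow> (f has_real_derivative D r) (at r)" "continuous_on {R\<^sub>0<..} D"
    using assms
    by (auto simp: C1_differentiable_on_def has_real_derivative_iff_has_vector_derivative)
  have eq: "deriv f r = D r" if "r > R\<^sub>0" for r
    using D(1)[OF that] by (rule DERIV_imp_deriv)
  show "r > R\<^sub>0 \<Longrightarrow> (f has_real_derivative deriv f r) (at r)" using D(1) eq by simp
  show "continuous_on {R\<^sub>0<..} (deriv f)"
    using D(2) eq by (subst continuous_on_cong[OF refl, of _ _ D]) auto
qed

lemma solution_deriv: "r > R\<^sub>0 \<Longrightarrow> (v has_real_derivative deriv v r) (at r)"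
  and continuous_on_deriv: "continuous_on {R\<^sub>0<..} (deriv v)"
  using C1_deriv[of v] sol by (auto simp: ode_solution_def)

lemma continuous_on_solution: "continuous_on {R\<^sub>0<..} v"
  by (intro continuous_at_imp_continuous_on ballI DERIV_isCont[OF solution_deriv]) auto

lemma flux_deriv:
  assumes "r > R\<^sub>0"
  shows "(flux N p v has_real_derivative
           - (\<mu> * r powr (N - 1 - p) * v r powr (p - 1) + r powr (N - 1 + s) * v r powr q)) (at r)"
proof -
  have "- deriv (flux N p v) r = \<mu> * r powr (N - 1 - p) * v r powr (p - 1) + r powr (N - 1 + s) * v r powr q"
    using sol assms by (simp add: ode_solution_def)
  thus ?thesis using C1_deriv(1)[of "flux N p v" r] sol assms
    unfolding ode_solution_def by (metis minus_minus)
qed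

text \<open>If the flux were never negative, \<open>v\<close> would be nondecreasing and
  \<open>r powr \<gamma> * v r\<close> could not tend to 0. Once negative, the flux stays so,
  because the equation makes it nonincreasing. This sign makes \<open>W\<close> positive.\<close>

lemma eventually_decreasing:
  assumes "\<mu> > 0" "\<gamma> > 0" and lim: "((\<lambda>r. r powr \<gamma> * v r) \<longlongrightarrow> 0) at_top"
  obtains R1 where "R1 > R\<^sub>0" "\<And>r. r \<ge> R1 \<Longrightarrow> deriv v r < 0"
proof -
  have "\<exists>R1>R\<^sub>0. flux N p v R1 < 0"
  proof (rule ccontr)
    assume "\<not> (\<exists>R1>R\<^sub>0. flux N p v R1 < 0)"
    hence nonneg: "deriv v r \<ge> 0" if "r > R\<^sub>0" for r
      using that R0 flux_neg_iff[of r N p v] by force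
    \<comment> \<open>The shift by 1 ensures \<open>r powr \<gamma> \<ge> 1\<close> for all
      \<open>r \<ge> r1\<close>.\<close>
    define r1 where "r1 = R\<^sub>0 + 1"
    have "v r1 > 0" by (rule solution_pos) (simp add: r1_def)
    have "v r1 \<le> r powr \<gamma> * v r" if "r \<ge> r1" for r
    proof -
      have "v r1 \<le> v r"
      proof (rule DERIV_nonneg_imp_nondecreasing[OF that])
        fix x assume "r1 \<le> x" "x \<le> r"
        hence "x > R\<^sub>0" by (simp add: r1_def)
        thus "\<exists>y. (v has_real_derivative y) (at x) \<and> 0 \<le> y" using solution_deriv nonneg by blast
      qed
      moreover have "1 \<le> r powr \<gamma>" using that R0 assms by (intro ge_one_powr_ge_zero) (auto simp: r1_def)
      ultimately show ?thesis
        using \<open>v r1 > 0\<close> mult_mono[of 1 "r powr \<gamma>" "v r1" "v r"] by simp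
    qed
    hence "eventually (\<lambda>r. v r1 \<le> r powr \<gamma> * v r) at_top"
      by (rule eventually_at_top_linorderI)
    hence "v r1 \<le> 0" using tendsto_lowerbound[OF lim] by simp
    thus False using \<open>v r1 > 0\<close> by simp
  qed
  then obtain R1 where R1: "R1 > R\<^sub>0" "flux N p v R1 < 0" by blast
  have "deriv v r < 0" if "r \<ge> R1" for r
  proof -
    have "flux N p v r \<le> flux N p v R1"
    proof (rule DERIV_nonpos_imp_nonincreasing[OF that])
      fix x assume "R1 \<le> x" "x \<le> r"
      hence "x > R\<^sub>0" using R1 by simp
      moreover have "0 \<le> \<mu> * x powr (N - 1 - p) * v x powr (p - 1) + x powr (N - 1 + s) * v x powr q"
        using assms by (intro add_nonneg_nonneg mult_nonneg_nonneg) auto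
      hence "- (\<mu> * x powr (N - 1 - p) * v x powr (p - 1) + x powr (N - 1 + s) * v x powr q) \<le> 0"
        by linarith
      ultimately show "\<exists>y. (flux N p v has_real_derivative y) (at x) \<and> y \<le> 0"
        using flux_deriv by blast
    qed
    thus ?thesis using R1 R0 that flux_neg_iff[of r N p v] by simp
  qed
  with R1 show ?thesis by (intro that)
qed

text \<open>This writes the power of \<open>W\<close> through the flux, whose derivative the
  equation gives. Where \<open>v\<close> decreases all factors are exponentials, and the claim
  becomes a linear identity between exponents.\<close>

lemma log_deriv_eq:
  assumes t: "exp t > R\<^sub>0" and neg: "deriv v (exp t) < 0"
  shows "(- exp t * deriv v (exp t) / v (exp t)) powr (p - 1)
           = - flux N p v (exp t) * exp ((p - N) * t - (p - 1) * ln (v (exp t)))"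
proof -
  define D where "D = ln (- deriv v (exp t))"
  define V where "V = ln (v (exp t))"
  have d: "deriv v (exp t) = - exp D" using neg by (simp add: D_def)
  have v: "v (exp t) = exp V" using solution_pos[OF t] by (simp add: V_def)
  have "- exp t * deriv v (exp t) / v (exp t) = exp (t + D - V)"
    by (simp add: d v exp_add exp_diff)
  hence "(- exp t * deriv v (exp t) / v (exp t)) powr (p - 1) = exp ((p - 1) * (t + D - V))"
    by (simp add: powr_def)
  moreover have "- flux N p v (exp t) = exp ((N - 1) * t + (p - 2) * D + D)"
    by (simp add: flux_def d powr_def exp_add)
  ultimately show ?thesis
    by (simp add: V_def[symmetric] algebra_simps flip: exp_add)
qed

text \<open>The product rule is applied to minus the flux times \<open>E\<close>. Differentiating
  \<open>E\<close> yields \<open>- h_fun\<close>; differentiating the flux brings in the equation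
  and yields \<open>\<mu>\<close> plus the exponential.\<close>

lemma log_deriv_powr_deriv:
  assumes "t > ln R1" "R1 > R\<^sub>0" and neg: "\<And>r. r \<ge> R1 \<Longrightarrow> deriv v r < 0"
  shows "((\<lambda>t. (- exp t * deriv v (exp t) / v (exp t)) powr (p - 1)) has_real_derivative
           \<mu> - h_fun N p (- exp t * deriv v (exp t) / v (exp t))
             + exp ((p + s) * t + (q - p + 1) * ln (v (exp t)))) (at t)"
    (is "(?Y has_real_derivative ?D) (at t)")
proof -
  define V where "V t = ln (v (exp t))" for t
  define W where "W t = - exp t * deriv v (exp t) / v (exp t)" for t
  define E where "E t = exp ((p - N) * t - (p - 1) * V t)" for t
  have *: "exp u > R1" if "u > ln R1" for u
    using that \<open>R1 > R\<^sub>0\<close> R0 by (metis exp_less_mono exp_ln less_trans)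
  note t = *[OF \<open>t > ln R1\<close>]
  have Y: "?Y u = - flux N p v (exp u) * E u" if "u > ln R1" for u
    unfolding E_def V_def using *[OF that] \<open>R1 > R\<^sub>0\<close> neg by (intro log_deriv_eq) auto
  have vpos: "v (exp t) > 0" using t \<open>R1 > R\<^sub>0\<close> by (intro solution_pos) auto
  have "((\<lambda>t. v (exp t)) has_real_derivative deriv v (exp t) * exp t) (at t)"
    using t \<open>R1 > R\<^sub>0\<close> by (intro DERIV_chain2[OF solution_deriv DERIV_exp]) auto
  hence "(V has_real_derivative - W t) (at t)"
    unfolding V_def [abs_def] W_def using vpos
    by (auto intro!: derivative_eq_intros simp: field_simps)
  hence E: "(E has_real_derivative E t * ((p - N) + (p - 1) * W t)) (at t)"
    unfolding E_def [abs_def]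
    by (auto intro!: derivative_eq_intros simp: algebra_simps)
  define F where "F = \<mu> * exp t powr (N - 1 - p) * v (exp t) powr (p - 1)
                        + exp t powr (N - 1 + s) * v (exp t) powr q"
  have "((\<lambda>t. flux N p v (exp t)) has_real_derivative - F * exp t) (at t)"
    unfolding F_def using t \<open>R1 > R\<^sub>0\<close> by (intro DERIV_chain2[OF flux_deriv DERIV_exp]) auto
  hence "((\<lambda>t. - flux N p v (exp t) * E t) has_real_derivative
            - flux N p v (exp t) * (E t * ((p - N) + (p - 1) * W t)) + - (- F * exp t) * E t) (at t)"
    by (intro DERIV_mult' DERIV_minus E)
  moreover have "- flux N p v (exp t) * (E t * ((p - N) + (p - 1) * W t)) = - h_fun N p (W t)"
  proof -
    have "- flux N p v (exp t) * (E t * ((p - N) + (p - 1) * W t))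
        = (- flux N p v (exp t) * E t) * ((p - N) + (p - 1) * W t)" by simp
    also have "- flux N p v (exp t) * E t = W t powr (p - 1)"
      using Y[OF \<open>t > ln R1\<close>] by (simp add: W_def)
    finally show ?thesis by (simp add: h_fun_def algebra_simps)
  qed
  \<comment> \<open>The factor \<open>exp t\<close> stems from the chain rule. In the term with
    \<open>\<mu>\<close> all exponents cancel.\<close>
  moreover have "- (- F * exp t) * E t = \<mu> + exp ((p + s) * t + (q - p + 1) * V t)"
  proof -
    have v: "v (exp t) = exp (V t)" using vpos by (simp add: V_def)
    have "- (- F * exp t) * E t
        = \<mu> * (exp ((N - 1 - p) * t) * exp ((p - 1) * V t) * exp t * E t)
          + exp ((N - 1 + s) * t) * exp (q * V t) * exp t * E t"
      by (simp add: F_def v powr_def algebra_simps)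
    also have "exp ((N - 1 - p) * t) * exp ((p - 1) * V t) * exp t * E t = exp 0"
      unfolding E_def exp_add[symmetric] by (rule arg_cong[of _ _ exp]) (simp add: algebra_simps)
    also have "exp ((N - 1 + s) * t) * exp (q * V t) * exp t * E t = exp ((p + s) * t + (q - p + 1) * V t)"
      unfolding E_def exp_add[symmetric] by (rule arg_cong[of _ _ exp]) (simp add: algebra_simps)
    finally show ?thesis by simp
  qed
  moreover have "- h_fun N p (W t) + (\<mu> + exp ((p + s) * t + (q - p + 1) * V t)) = ?D"
    by (simp add: V_def W_def)
  ultimately have "((\<lambda>t. - flux N p v (exp t) * E t) has_real_derivative ?D) (at t)"
    by metis
  moreover have ev: "eventually (\<lambda>u. - flux N p v (exp u) * E u = ?Y u) (nhds t)"
    by (rule eventually_mono[OF eventually_nhds_in_open[of "{ln R1<..}"]])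
       (use \<open>t > ln R1\<close> Y in auto)
  ultimately show ?thesis
    using iffD1[OF DERIV_cong_ev[OF refl ev refl]] by blast
qed

lemma log_derivative_flow_solution:
  assumes "1 < p" "p < N" "0 < nu_minus" "nu_minus < nu_plus"
    "h_fun N p nu_minus = \<mu>" "h_fun N p nu_plus = \<mu>" "\<mu> > 0"
    "nu_minus < gamma_star p s q" "gamma_star p s q < (N - p) / p" "q - p + 1 > 0"
    and R1: "R1 > R\<^sub>0" "\<And>r. r \<ge> R1 \<Longrightarrow> deriv v r < 0"
    and lim: "((\<lambda>r. r powr gamma_star p s q * v r) \<longlongrightarrow> 0) at_top"
  shows "log_derivative_flow N p \<mu> nu_minus nu_plus (gamma_star p s q) (q - p + 1) (ln R1)
           (\<lambda>t. ln (v (exp t))) (\<lambda>t. - exp t * deriv v (exp t) / v (exp t))"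
proof
  fix t assume t: "t > ln R1"
  hence e: "exp t > R1" using R1 R0 by (metis exp_less_mono exp_ln less_trans)
  have vpos: "v (exp t) > 0" using e R1 by (intro solution_pos) auto
  show "- exp t * deriv v (exp t) / v (exp t) > 0"
    using vpos R1(2)[of "exp t"] e by (intro divide_pos_pos) (auto intro: mult_pos_neg)
  have "((\<lambda>t. v (exp t)) has_real_derivative deriv v (exp t) * exp t) (at t)"
    using e R1 by (intro DERIV_chain2[OF solution_deriv DERIV_exp]) auto
  thus "((\<lambda>t. ln (v (exp t))) has_real_derivative - (- exp t * deriv v (exp t) / v (exp t))) (at t)"
    using vpos by (auto intro!: derivative_eq_intros simp: field_simps)
  have "(q - p + 1) * (gamma_star p s q * t + x) = (p + s) * t + (q - p + 1) * x" for x
    using \<open>q - p + 1 > 0\<close> by (simp add: gamma_star_def field_simps)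
  thus "((\<lambda>t. (- exp t * deriv v (exp t) / v (exp t)) powr (p - 1)) has_real_derivative
           \<mu> - h_fun N p (- exp t * deriv v (exp t) / v (exp t))
             + exp ((q - p + 1) * (gamma_star p s q * t + ln (v (exp t))))) (at t)"
    using log_deriv_powr_deriv[OF t R1] by simp
next
  \<comment> \<open>\<open>?f\<close> is positive near infinity, so it tends to 0 from the right and
    its logarithm to minus infinity.\<close>
  let ?f = "\<lambda>t. exp t powr gamma_star p s q * v (exp t)"
  have pos: "eventually (\<lambda>t. v (exp t) > 0) at_top"
    using eventually_gt_at_top[of "ln R\<^sub>0"]
  proof eventually_elim
    fix t assume "t > ln R\<^sub>0"
    hence "exp t > R\<^sub>0" using R0 by (metis exp_less_mono exp_ln)
    thus "v (exp t) > 0" by (rule solution_pos)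
  qed
  have "(?f \<longlongrightarrow> 0) at_top" by (rule filterlim_compose[OF lim exp_at_top])
  moreover have "eventually (\<lambda>t. ?f t > 0) at_top" using pos by eventually_elim simp
  ultimately have "filterlim ?f (at_right 0) at_top" by (rule tendsto_imp_filterlim_at_right)
  hence *: "filterlim (\<lambda>t. ln (?f t)) at_bot at_top" by (rule filterlim_compose[OF ln_at_0])
  have ev: "eventually (\<lambda>t. ln (?f t) = gamma_star p s q * t + ln (v (exp t))) at_top"
    using pos by eventually_elim (simp add: ln_mult ln_powr)
  show "filterlim (\<lambda>t. gamma_star p s q * t + ln (v (exp t))) at_bot at_top"
    using * by (rule iffD1[OF filterlim_cong[OF refl refl ev]])
qed (use assms in auto)

end

section \<open>Return to the variable \<open>r\<close>: the equivalence and the three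
  integrals\<close>

theorem corollary1p4:
  fixes N p s \<mu> q nu_minus nu_plus R\<^sub>0 :: real and v :: "real \<Rightarrow> real"
  assumes "1 < p" and "p < N"
    and "s > - p"
    and "0 < \<mu>" and "\<mu> < mu_bar N p"
    and "0 < nu_minus" and "nu_minus < nu_plus" and "h_fun N p nu_minus = \<mu>" and "h_fun N p nu_plus = \<mu>"
    and "p_star N p s - 1 < q" and "q < q_bar p s nu_minus"
    and "R\<^sub>0 > 0"
    and "ode_solution N p s \<mu> q R\<^sub>0 v"
  shows "(((\<lambda>r. r powr gamma_star p s q * v r) \<longlongrightarrow> 0) at_top \<longleftrightarrow>
           (\<exists>L>0. ((\<lambda>r. r powr nu_plus * v r) \<longlongrightarrow> L) at_top)) \<and>
         (((\<lambda>r. r powr gamma_star p s q * v r) \<longlongrightarrow> 0) at_top \<longrightarrow>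
           (\<forall>R>R\<^sub>0.
             set_integrable lborel {R..} (\<lambda>r. r powr (N - 1) * \<bar>deriv v r\<bar> powr p) \<and>
             set_integrable lborel {R..} (\<lambda>r. r powr (N - 1 - p) * v r powr p) \<and>
             set_integrable lborel {R..} (\<lambda>r. r powr (N - 1 + s) * v r powr (q + 1))))"
proof -
  note p = \<open>1 < p\<close> \<open>p < N\<close>
  note sol = \<open>ode_solution N p s \<mu> q R\<^sub>0 v\<close> and R0 = \<open>R\<^sub>0 > 0\<close>
  define \<gamma> where "\<gamma> = gamma_star p s q"
  define \<beta> where "\<beta> = q - p + 1"
  \<comment> \<open>In terms of \<open>\<beta>\<close> the lower bound on \<open>q\<close> gives
    \<open>\<beta> > 0\<close> and \<open>\<gamma> < (N - p) / p\<close>, and the upper bound gives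
    \<open>nu_minus < \<gamma>\<close>.\<close>
  have "p * (N + s) / (N - p) = p + p * (p + s) / (N - p)"
    using p by (simp add: field_simps)
  hence \<beta>_gt: "\<beta> > p * (p + s) / (N - p)"
    using \<open>p_star N p s - 1 < q\<close> by (simp add: p_star_def \<beta>_def)
  moreover have "p * (p + s) / (N - p) > 0" using p \<open>s > - p\<close> by simp
  ultimately have \<beta>: "\<beta> > 0" by linarith
  have \<gamma>_eq: "\<gamma> = (p + s) / \<beta>" by (simp only: \<gamma>_def \<beta>_def gamma_star_def)
  hence \<gamma>\<beta>: "\<gamma> * \<beta> = p + s" using \<beta> by simp
  have "(p + s) * p < \<beta> * (N - p)" using \<beta>_gt p by (simp add: field_simps)
  hence \<gamma>_lt: "\<gamma> < (N - p) / p"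
    using \<beta> p by (simp add: \<gamma>_eq field_simps)
  have "\<beta> < (p + s) / nu_minus" using \<open>q < q_bar p s nu_minus\<close> by (simp add: \<beta>_def q_bar_def)
  hence \<gamma>_gt: "nu_minus < \<gamma>"
    using \<beta> \<open>0 < nu_minus\<close> by (simp add: \<gamma>_eq field_simps)
  have nu_plus_gt: "(N - p) / p < nu_plus"
    using h_fun_strict_mono[of p nu_minus nu_plus N] assms by force
  have pos: "v r > 0" if "r > R\<^sub>0" for r using solution_pos[OF sol R0 that] .
  have forward: "(\<exists>L>0. ((\<lambda>r. r powr nu_plus * v r) \<longlongrightarrow> L) at_top) \<and>
      (\<forall>R>R\<^sub>0. set_integrable lborel {R..} (\<lambda>r. r powr (N - 1) * \<bar>deriv v r\<bar> powr p) \<and>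
             set_integrable lborel {R..} (\<lambda>r. r powr (N - 1 - p) * v r powr p) \<and>
             set_integrable lborel {R..} (\<lambda>r. r powr (N - 1 + s) * v r powr (q + 1)))"
    if lim: "((\<lambda>r. r powr \<gamma> * v r) \<longlongrightarrow> 0) at_top"
  proof -
    have "\<gamma> > 0" using \<gamma>_gt \<open>0 < nu_minus\<close> by simp
    then obtain R1 where R1: "R1 > R\<^sub>0" "\<And>r. r \<ge> R1 \<Longrightarrow> deriv v r < 0"
      using eventually_decreasing[OF sol R0 \<open>0 < \<mu>\<close> _ lim] by blast
    interpret log_derivative_flow N p \<mu> nu_minus nu_plus \<gamma> \<beta> "ln R1"
      "\<lambda>t. ln (v (exp t))" "\<lambda>t. - exp t * deriv v (exp t) / v (exp t)"
      unfolding \<gamma>_def \<beta>_def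
      by (rule log_derivative_flow_solution[OF sol R0])
         (use assms \<gamma>_gt \<gamma>_lt \<beta> R1 lim in \<open>simp_all add: \<gamma>_def \<beta>_def\<close>)
    obtain L where "((\<lambda>t. nu_plus * t + ln (v (exp t))) \<longlongrightarrow> L) at_top"
      using nu_plus_limit by blast
    hence L: "((\<lambda>r. exp (nu_plus * ln r + ln (v (exp (ln r))))) \<longlongrightarrow> exp L) at_top"
      by (intro tendsto_exp filterlim_compose[OF _ ln_at_top])
    have ev: "eventually (\<lambda>r. exp (nu_plus * ln r + ln (v (exp (ln r)))) = r powr nu_plus * v r) at_top"
      using eventually_gt_at_top[of "R\<^sub>0"]
      by eventually_elim (use R0 pos in \<open>simp add: exp_add powr_def\<close>)
    have limL: "((\<lambda>r. r powr nu_plus * v r) \<longlongrightarrow> exp L) at_top"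
      using L by (rule iffD1[OF tendsto_cong[OF ev]])
    have "eventually (\<lambda>r. r > R1 \<and> r powr nu_plus * v r < exp L + 1 \<and> r powr \<gamma> * v r < 1) at_top"
      using order_tendstoD(2)[OF limL, of "exp L + 1"] order_tendstoD(2)[OF lim, of 1]
      by (intro eventually_conj eventually_gt_at_top) auto
    then obtain R2 where R2: "\<And>r. r \<ge> R2 \<Longrightarrow> r > R1"
        "\<And>r. r \<ge> R2 \<Longrightarrow> r powr nu_plus * v r < exp L + 1"
        "\<And>r. r \<ge> R2 \<Longrightarrow> r powr \<gamma> * v r < 1"
      by (auto simp: eventually_at_top_linorder)
    \<comment> \<open>This exponent results from inserting the decay
      \<open>r powr (- nu_plus)\<close> of \<open>v\<close> into
      \<open>r powr (N - 1 - p) * v r powr p\<close>. It lies below -1 because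
      \<open>nu_plus > (N - p) / p\<close>.\<close>
    define e where "e = N - 1 - p - p * nu_plus"
    have "N - p < p * nu_plus" using nu_plus_gt p by (simp add: field_simps)
    hence e: "e < -1" by (simp add: e_def)
    define M where "M = (exp L + 1) powr p"
    have v_bound: "r powr (N - 1 - p) * v r powr p \<le> M * r powr e" if "r \<ge> R2" for r
    proof -
      have r: "r > 0" "v r > 0" using R2(1)[OF that] R1 R0 pos by auto
      have "(r powr nu_plus * v r) powr p \<le> M"
        unfolding M_def using R2(2)[OF that] r p by (intro powr_mono2) auto
      hence "r powr e * (r powr nu_plus * v r) powr p \<le> r powr e * M"
        by (intro mult_left_mono) auto
      moreover have "r powr e * (r powr nu_plus * v r) powr p = r powr (e + p * nu_plus) * v r powr p"
        using r by (simp add: powr_mult powr_powr powr_add mult.commute)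
      ultimately show ?thesis by (simp add: e_def mult.commute)
    qed
    \<comment> \<open>The bound \<open>W < nu_plus\<close> means
      \<open>\<bar>deriv v r\<bar> < nu_plus * v r / r\<close>, which reduces the gradient term to
      \<open>v_bound\<close>.\<close>
    have d_bound: "r powr (N - 1) * \<bar>deriv v r\<bar> powr p \<le> (nu_plus powr p * M) * r powr e" if "r \<ge> R2" for r
    proof -
      have r: "r > R1" "r > 0" "v r > 0" using R2(1)[OF that] R1 R0 pos by auto
      have "ln r > ln R1" using r R1 R0 by simp
      hence "- r * deriv v r / v r < nu_plus" using W_less_nu_plus[of "ln r"] r by simp
      hence "\<bar>deriv v r\<bar> \<le> nu_plus * v r / r" using r R1(2)[of r] by (simp add: field_simps)
      hence "\<bar>deriv v r\<bar> powr p \<le> (nu_plus * v r / r) powr p"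
        using p by (intro powr_mono2) auto
      also have "\<dots> = nu_plus powr p * v r powr p * r powr (- p)"
        using r nu by (simp add: powr_mult powr_divide powr_minus_divide)
      finally have "r powr (N - 1) * \<bar>deriv v r\<bar> powr p
          \<le> r powr (N - 1) * (nu_plus powr p * v r powr p * r powr (- p))"
        by (intro mult_left_mono) auto
      also have "\<dots> = nu_plus powr p * (r powr (N - 1 + - p) * v r powr p)"
        by (simp only: powr_add mult_ac)
      also have "\<dots> \<le> nu_plus powr p * (M * r powr e)"
        using v_bound[OF that] by (intro mult_left_mono) auto
      finally show ?thesis by (simp add: mult_ac)
    qed
    \<comment> \<open>This integrand is the one of \<open>v_bound\<close> times
      \<open>(r powr \<gamma> * v r) powr \<beta>\<close>, a factor that is eventually at most
      1.\<close>
    have q_bound: "r powr (N - 1 + s) * v r powr (q + 1) \<le> M * r powr e" if "r \<ge> R2" for r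
    proof -
      have r: "r > 0" "v r > 0" using R2(1)[OF that] R1 R0 pos by auto
      have "(r powr \<gamma> * v r) powr \<beta> \<le> 1"
        using R2(3)[OF that] r \<beta> by (intro powr_le1) auto
      hence "(r powr (N - 1 - p) * v r powr p) * (r powr \<gamma> * v r) powr \<beta> \<le> r powr (N - 1 - p) * v r powr p"
        by (intro mult_left_le) auto
      moreover have "(r powr (N - 1 - p) * v r powr p) * (r powr \<gamma> * v r) powr \<beta>
          = r powr (N - 1 - p + \<gamma> * \<beta>) * v r powr (p + \<beta>)"
        using r by (simp add: powr_mult powr_powr powr_add)
      moreover have "N - 1 - p + \<gamma> * \<beta> = N - 1 + s" "p + \<beta> = q + 1"
        unfolding \<gamma>\<beta> by (simp_all add: \<beta>_def)
      ultimately show ?thesis using v_bound[OF that] by simp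
    qed
    show ?thesis
    proof (intro conjI allI impI)
      show "\<exists>L>0. ((\<lambda>r. r powr nu_plus * v r) \<longlongrightarrow> L) at_top" using limL by (intro exI[of _ "exp L"]) simp
    next
      fix R assume R: "R > R\<^sub>0"
      have cv: "continuous_on {R..} v"
        by (rule continuous_on_subset[OF continuous_on_solution[OF sol R0]]) (use R in auto)
      have cd: "continuous_on {R..} (deriv v)"
        by (rule continuous_on_subset[OF continuous_on_deriv[OF sol R0]]) (use R in auto)
      have cp: "continuous_on {R..} (\<lambda>r. r powr a)" for a :: real
        using R R0 by (intro continuous_on_powr continuous_intros) auto
      have cvp: "continuous_on {R..} (\<lambda>r. v r powr a)" for a :: real
      proof (intro continuous_on_powr cv continuous_on_const ballI)
        fix r assume "r \<in> {R..}"
        thus "v r \<noteq> 0" using pos[of r] R by auto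
      qed
      \<comment> \<open>Between \<open>R\<close> and \<open>R1\<close> the derivative may vanish;
        continuity of the power at base 0 rests on \<open>p > 0\<close>.\<close>
      have cdp: "continuous_on {R..} (\<lambda>r. \<bar>deriv v r\<bar> powr p)"
        using p by (intro continuous_on_powr' continuous_on_rabs cd continuous_on_const) auto
      have "R > 0" using R R0 by simp
      show "set_integrable lborel {R..} (\<lambda>r. r powr (N - 1) * \<bar>deriv v r\<bar> powr p)"
        by (rule set_integrable_powr_decay[OF _ \<open>R > 0\<close> e, of _ R2 "nu_plus powr p * M"])
           (use d_bound in \<open>auto intro: continuous_on_mult cp cdp simp: abs_mult\<close>)
      show "set_integrable lborel {R..} (\<lambda>r. r powr (N - 1 - p) * v r powr p)"
        by (rule set_integrable_powr_decay[OF _ \<open>R > 0\<close> e, of _ R2 M])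
           (use v_bound in \<open>auto intro: continuous_on_mult cp cvp simp: abs_mult\<close>)
      show "set_integrable lborel {R..} (\<lambda>r. r powr (N - 1 + s) * v r powr (q + 1))"
        by (rule set_integrable_powr_decay[OF _ \<open>R > 0\<close> e, of _ R2 M])
           (use q_bound in \<open>auto intro: continuous_on_mult cp cvp simp: abs_mult\<close>)
    qed
  qed
  have backward: "((\<lambda>r. r powr \<gamma> * v r) \<longlongrightarrow> 0) at_top"
    if lim: "((\<lambda>r. r powr nu_plus * v r) \<longlongrightarrow> L) at_top" for L
  proof -
    \<comment> \<open>The exponent is negative because \<open>(N - p) / p\<close> separates
      \<open>\<gamma>\<close> from \<open>nu_plus\<close>.\<close>
    have "((\<lambda>r. r powr (\<gamma> - nu_plus)) \<longlongrightarrow> 0) at_top"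
      using \<gamma>_lt nu_plus_gt by (intro tendsto_neg_powr filterlim_ident) simp
    from tendsto_mult[OF this lim]
    have "((\<lambda>r. r powr (\<gamma> - nu_plus) * (r powr nu_plus * v r)) \<longlongrightarrow> 0) at_top" by simp
    thus ?thesis by (simp add: mult.assoc[symmetric] powr_add[symmetric])
  qed
  show ?thesis using forward backward unfolding \<gamma>_def by blast
qed

end
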